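(* For any $u_0\in M_n$, the heat equation $u_t=-\Delta u$, $u(0)=u_0$, for $u=u(t)\in M_n$, has a global solution $u(t)$, $t\ge 0$, and $\lim_{t\to\infty}u(t)=\bar u_0$. Furthermore, if $u_0>0$ (i.e. $u_0$ is positive definite), then $u(t)>0$ for all $t>0$.
   Context: Let $x,y$ be $n\times n$ Hermitian matrices, and set $U=e^{2\pi i x/n}$, $V=e^{2\pi i y/n}$. It is assumed that $U,V$ generate the algebra $M_n$ of all $n\times n$ complex matrices, so that the commutant of $\{U,V\}$ is $\mathbb{C}I$, the scalar multiples of the identity matrix $I$. Let $\tau$ be the usual (unnormalized) trace on $M_n$, and equip $M_n$ with the Hilbert-Schmidt inner product $\langle a,b\rangle=\tau(a^*b)$, where $a^*$ is the conjugate transpose. Define the derivations $\delta_1=[y,\cdot]$ and $\delta_2=-[x,\cdot]$ on $M_n$, where $[a,b]=ab-ba$. The Laplacian is the nonnegative operator $\Delta=\delta_1^*\delta_1+\delta_2^*\delta_2$, where $\delta_\mu^*$ is the adjoint of $\delta_\mu$ with respect to $\langle\cdot,\cdot\rangle$; explicitly, $\Delta a=[y,[y,a]]+[x,[x,a]]$. For $a\in M_n$ write $\bar a=\frac{\tau(a)}{n}I$. Here $u_t=\frac{d}{dt}u(t)$. *)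

theory Defs
  imports "HOL-Analysis.Analysis"
begin

text \<open>Square complex matrices of size \<open>n = CARD('n)\<close> have the type \<open>complex ^ 'n ^ 'n\<close>, with
  matrix product \<open>**\<close> and identity \<open>mat 1\<close>. The library's norm on this type is the
  Hilbert-Schmidt (Frobenius) norm. The type class operations \<open>*\<close> and \<open>^\<close> act entrywise on it, so
  \<open>exp\<close> cannot be used.\<close>

definition mscale :: "complex \<Rightarrow> complex ^ 'n ^ 'n \<Rightarrow> complex ^ 'n ^ 'n" where
  "mscale c a = map_matrix (\<lambda>z. c * z) a"

definition mexp :: "complex ^ 'n ^ 'n \<Rightarrow> complex ^ 'n ^ 'n" where
  "mexp a = (\<Sum>k. (1 / fact k) *\<^sub>R (((**) a ^^ k) (mat 1)))"

definition conj_transpose :: "complex ^ 'n ^ 'n \<Rightarrow> complex ^ 'n ^ 'n" where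
  "conj_transpose a = map_matrix cnj (transpose a)"

definition hermitian :: "complex ^ 'n ^ 'n \<Rightarrow> bool" where
  "hermitian a \<longleftrightarrow> conj_transpose a = a"

text \<open>For hermitian \<open>a\<close> the number \<open>v\<^sup>* a v\<close> is real, so taking its real part loses nothing.\<close>

definition pos_definite :: "complex ^ 'n ^ 'n \<Rightarrow> bool" where
  "pos_definite a \<longleftrightarrow>
     hermitian a \<and> (\<forall>v. v \<noteq> 0 \<longrightarrow> 0 < Re (\<Sum>i\<in>UNIV. cnj (v $ i) * (a *v v) $ i))"

inductive_set generated_algebra :: "(complex ^ 'n ^ 'n) set \<Rightarrow> (complex ^ 'n ^ 'n) set"
  for S :: "(complex ^ 'n ^ 'n) set" where
  gen: "a \<in> S \<Longrightarrow> a \<in> generated_algebra S"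
| one: "mat 1 \<in> generated_algebra S"
| add: "a \<in> generated_algebra S \<Longrightarrow> b \<in> generated_algebra S \<Longrightarrow> a + b \<in> generated_algebra S"
| scale: "a \<in> generated_algebra S \<Longrightarrow> mscale c a \<in> generated_algebra S"
| mult: "a \<in> generated_algebra S \<Longrightarrow> b \<in> generated_algebra S \<Longrightarrow> a ** b \<in> generated_algebra S"

definition hs_inner :: "complex ^ 'n ^ 'n \<Rightarrow> complex ^ 'n ^ 'n \<Rightarrow> complex" where
  "hs_inner a b = trace (conj_transpose a ** b)"

text \<open>The library's \<open>adjoint\<close> refers to the real inner product, hence a separate notion.\<close>

definition hs_adjoint ::
  "(complex ^ 'n ^ 'n \<Rightarrow> complex ^ 'n ^ 'n) \<Rightarrow> complex ^ 'n ^ 'n \<Rightarrow> complex ^ 'n ^ 'n" where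
  "hs_adjoint T = (THE S. \<forall>a b. hs_inner (S a) b = hs_inner a (T b))"

definition commutator :: "complex ^ 'n ^ 'n \<Rightarrow> complex ^ 'n ^ 'n \<Rightarrow> complex ^ 'n ^ 'n" where
  "commutator a b = a ** b - b ** a"

definition delta1 :: "complex ^ 'n ^ 'n \<Rightarrow> complex ^ 'n ^ 'n \<Rightarrow> complex ^ 'n ^ 'n" where
  "delta1 y a = commutator y a"

definition delta2 :: "complex ^ 'n ^ 'n \<Rightarrow> complex ^ 'n ^ 'n \<Rightarrow> complex ^ 'n ^ 'n" where
  "delta2 x a = - commutator x a"

definition laplacian ::
  "complex ^ 'n ^ 'n \<Rightarrow> complex ^ 'n ^ 'n \<Rightarrow> complex ^ 'n ^ 'n \<Rightarrow> complex ^ 'n ^ 'n" where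
  "laplacian x y a =
     hs_adjoint (delta1 y) (delta1 y a) + hs_adjoint (delta2 x) (delta2 x a)"

definition mean :: "complex ^ 'n ^ 'n \<Rightarrow> complex ^ 'n ^ 'n" where
  "mean a = mscale (trace a / of_nat CARD('n)) (mat 1)"

text \<open>At \<open>t = 0\<close> the derivative is one-sided; the values of \<open>u\<close> at negative times are irrelevant.\<close>

definition heat_solution ::
  "complex ^ 'n ^ 'n \<Rightarrow> complex ^ 'n ^ 'n \<Rightarrow> complex ^ 'n ^ 'n \<Rightarrow> (real \<Rightarrow> complex ^ 'n ^ 'n) \<Rightarrow> bool"
  where
  "heat_solution x y u0 u \<longleftrightarrow> u 0 = u0 \<and>
     (\<forall>t\<ge>0. (u has_vector_derivative - laplacian x y (u t)) (at t within {0..}))"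

text \<open>The adjoints exist for hermitian \<open>x\<close>, \<open>y\<close>, and the Laplacian is the double commutator
  operator.\<close>

lemma hs_inner_diff_left: "hs_inner (a - b) c = hs_inner a c - hs_inner b c"
  by (simp add: hs_inner_def conj_transpose_def trace_def matrix_matrix_mult_def transpose_def
      algebra_simps sum_subtractf)

lemma hs_inner_self_eq_0:
  assumes "hs_inner a a = 0" shows "a = 0"
proof -
  have "Re (hs_inner a a) = (\<Sum>i\<in>UNIV. \<Sum>k\<in>UNIV. (cmod (a $ k $ i))\<^sup>2)"
    by (simp add: hs_inner_def conj_transpose_def trace_def matrix_matrix_mult_def transpose_def
        cmod_power2[unfolded power2_eq_square] power2_eq_square)
  then have "(\<Sum>i\<in>UNIV. \<Sum>k\<in>UNIV. (cmod (a $ k $ i))\<^sup>2) = 0"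
    using assms by simp
  then have "\<forall>i k. a $ k $ i = 0"
    by (simp add: sum_nonneg_eq_0_iff sum_nonneg)
  then show ?thesis by (simp add: vec_eq_iff)
qed

lemma hs_adjoint_eqI:
  assumes "\<And>a b. hs_inner (S a) b = hs_inner a (T b)"
  shows "hs_adjoint T = S"
  unfolding hs_adjoint_def
proof (rule the_equality)
  fix S' assume S': "\<forall>a b. hs_inner (S' a) b = hs_inner a (T b)"
  show "S' = S"
  proof
    fix a
    have "hs_inner (S' a - S a) (S' a - S a) = 0"
      using assms S' by (simp add: hs_inner_diff_left)
    then show "S' a = S a" using hs_inner_self_eq_0 by fastforce
  qed
qed (use assms in simp)

lemma hs_inner_commutator:
  assumes "hermitian y"
  shows "hs_inner (commutator y a) b = hs_inner a (commutator y b)"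
proof -
  have ct_mult: "conj_transpose (p ** q) = conj_transpose q ** conj_transpose p"
    for p q :: "complex ^ 'n ^ 'n"
    by (simp add: conj_transpose_def matrix_matrix_mult_def transpose_def vec_eq_iff mult.commute)
  have ct_diff: "conj_transpose (p - q) = conj_transpose p - conj_transpose q"
    for p q :: "complex ^ 'n ^ 'n"
    by (simp add: conj_transpose_def transpose_def vec_eq_iff)
  let ?a = "conj_transpose a"
  have y: "conj_transpose y = y" using assms by (simp add: hermitian_def)
  have diffl: "(p - q) ** r = p ** r - q ** r" and diffr: "r ** (p - q) = r ** p - r ** q"
    for p q r :: "complex ^ 'n ^ 'n"
    by (simp_all add: matrix_matrix_mult_def vec_eq_iff algebra_simps sum_subtractf)
  have "hs_inner (commutator y a) b = trace (?a ** (y ** b)) - trace (y ** (?a ** b))"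
    by (simp add: hs_inner_def commutator_def ct_diff ct_mult y diffl trace_sub matrix_mul_assoc)
  also have "trace (y ** (?a ** b)) = trace (?a ** (b ** y))"
    by (metis trace_mul_sym matrix_mul_assoc)
  finally show ?thesis
    by (simp add: hs_inner_def commutator_def diffr trace_sub)
qed

lemma laplacian_eq:
  assumes "hermitian x" "hermitian y"
  shows "laplacian x y a =
    commutator y (commutator y a) + commutator x (commutator x a)"
proof -
  have neg: "hs_inner (- p) q = - hs_inner p q" "hs_inner p (- q) = - hs_inner p q"
    for p q :: "complex ^ 'n ^ 'n"
    by (simp_all add: hs_inner_def conj_transpose_def trace_def matrix_matrix_mult_def
        transpose_def sum_negf)
  have "hs_adjoint (delta1 y) = delta1 y"
    by (rule hs_adjoint_eqI) (simp add: delta1_def hs_inner_commutator assms)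
  moreover have "hs_adjoint (delta2 x) = delta2 x"
    by (rule hs_adjoint_eqI) (simp add: delta2_def hs_inner_commutator assms neg)
  moreover have "commutator x (- p) = - commutator x p" for p
    by (simp add: commutator_def matrix_matrix_mult_def vec_eq_iff sum_negf)
  ultimately show ?thesis
    by (simp add: laplacian_def delta1_def delta2_def)
qed

end

theory Submission
  imports Defs
begin

text \<open>The Laplacian is symmetric and nonnegative for the real inner product, so it has an orthonormal
  eigenbasis \<open>b\<close> with eigenvalues \<open>\<lambda> b \<ge> 0\<close>, and \<open>\<Sum>b. exp (- \<lambda> b * t) * (u0 \<bullet> b) * b\<close> solves the heat
  equation and tends to the projection of \<open>u0\<close> onto the kernel. An element of the kernel commutes with
  \<open>x\<close> and \<open>y\<close>, hence with the algebra generated by \<open>U\<close> and \<open>V\<close>, and so is scalar.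
  The hermitian matrices form an invariant subspace, so the construction can be carried out inside it.
  Positivity is a maximum principle: \<open>w = u - (c - \<epsilon> t) I\<close> cannot reach the boundary of the positive
  cone, because at a first such time \<open>w v = 0\<close> for some unit vector \<open>v\<close>, and then
  \<open>- v\<^sup>* (\<Delta> w) v = 2 (y v)\<^sup>* w (y v) + 2 (x v)\<^sup>* w (x v) \<ge> 0\<close>, so that \<open>v\<^sup>* w v\<close> has derivative at least \<open>\<epsilon>\<close>.\<close>

section \<open>Symmetric operators\<close>

lemma quadratic_nonneg_imp_linear_coeff_0:
  fixes a b :: real
  assumes "\<And>s. 0 \<le> 2 * s * a + s\<^sup>2 * b"
  shows "a = 0"
proof (rule ccontr)
  assume a: "a \<noteq> 0"
  \<comment> \<open>This \<open>d\<close> is positive even for \<open>b = 0\<close> and exceeds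
    \<open>b\<close>, so the test point \<open>s = - a / d\<close> gives a negative value whatever
    the sign of \<open>b\<close>.\<close>
  define d where "d = \<bar>b\<bar> + 1"
  have d: "d > 0" "b < d" by (auto simp: d_def)
  have "0 \<le> 2 * (- a / d) * a + (- a / d)\<^sup>2 * b" by (rule assms)
  also have "\<dots> = a\<^sup>2 * (b - 2 * d) / d\<^sup>2"
    using d by (simp add: field_simps power2_eq_square)
  also have "\<dots> < 0"
    using d a by (intro divide_neg_pos mult_pos_neg) auto
  finally show False by simp
qed

text \<open>Moving from \<open>v\<close> in the direction \<open>f v\<close> changes the form to
  first order by \<open>2 * s * (f v \<bullet> f v)\<close>, which nonnegativity forces to vanish.
  It serves twice: to produce eigenvectors, and at a boundary point of the positive cone.\<close>

lemma symmetric_nonneg_null: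
  fixes f :: "'a::real_inner \<Rightarrow> 'a"
  assumes f: "linear f" and sym: "\<And>a b. f a \<bullet> b = a \<bullet> f b"
    and S: "subspace S" and nonneg: "\<And>z. z \<in> S \<Longrightarrow> 0 \<le> f z \<bullet> z"
    and v: "v \<in> S" "f v \<in> S" "f v \<bullet> v = 0"
  shows "f v = 0"
proof -
  have "0 \<le> 2 * s * (f v \<bullet> f v) + s\<^sup>2 * (f (f v) \<bullet> f v)" for s
  proof -
    have "v + s *\<^sub>R f v \<in> S" using S v by (simp add: subspace_add subspace_scale)
    then have "0 \<le> f (v + s *\<^sub>R f v) \<bullet> (v + s *\<^sub>R f v)" by (rule nonneg)
    also have "\<dots> = 2 * s * (f v \<bullet> f v) + s\<^sup>2 * (f (f v) \<bullet> f v)"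
      using v(3) sym[of "f v" v]
      by (simp add: linear_add[OF f] linear_scale[OF f] inner_simps power2_eq_square algebra_simps)
    finally show ?thesis .
  qed
  then have "f v \<bullet> f v = 0" by (rule quadratic_nonneg_imp_linear_coeff_0)
  then show ?thesis by simp
qed

text \<open>The Rayleigh quotient attains its maximum \<open>l\<close> on the compact unit sphere of
  \<open>S\<close>. Then \<open>l I - f\<close> is nonnegative on \<open>S\<close> and its form
  vanishes at the maximizer, which therefore lies in its kernel.\<close>

lemma symmetric_has_eigenvector:
  fixes f :: "'a::euclidean_space \<Rightarrow> 'a"
  assumes f: "linear f" and sym: "\<And>a b. f a \<bullet> b = a \<bullet> f b"
    and S: "subspace S" and inv: "\<And>a. a \<in> S \<Longrightarrow> f a \<in> S" and nz: "S \<noteq> {0}"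
  obtains v l where "v \<in> S" "norm v = 1" "f v = l *\<^sub>R v"
proof -
  have unit: "(1 / norm z) *\<^sub>R z \<in> S \<inter> sphere 0 1" if "z \<in> S" "z \<noteq> 0" for z
    using that S by (simp add: subspace_scale)
  obtain z where "z \<in> S" "z \<noteq> 0" using nz subspace_0[OF S] by blast
  then have ne: "S \<inter> sphere 0 1 \<noteq> {}" using unit by blast
  have comp: "compact (S \<inter> sphere 0 1)"
    by (simp add: S closed_Int_compact closed_subspace)
  have "continuous_on (S \<inter> sphere 0 1) (\<lambda>z. f z \<bullet> z)"
    by (intro continuous_intros linear_continuous_on linear_conv_bounded_linear[THEN iffD1] f)
  from continuous_attains_sup[OF comp ne this] obtain v where v: "v \<in> S" "norm v = 1"
    and max: "\<And>z. z \<in> S \<Longrightarrow> norm z = 1 \<Longrightarrow> f z \<bullet> z \<le> f v \<bullet> v"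
    by auto
  define l where "l = f v \<bullet> v"
  define g where "g z = l *\<^sub>R z - f z" for z
  have "g v = 0"
  proof (rule symmetric_nonneg_null[of g S])
    show "linear g"
      unfolding g_def by (intro linear_compose_sub linear_scaleR f)
    show "g a \<bullet> b = a \<bullet> g b" for a b
      by (simp add: g_def inner_simps sym)
    show "0 \<le> g z \<bullet> z" if "z \<in> S" for z
    proof (cases "z = 0")
      case False
      have "f ((1 / norm z) *\<^sub>R z) \<bullet> ((1 / norm z) *\<^sub>R z) \<le> l"
        unfolding l_def using max unit[OF that False] by (metis IntE mem_sphere_0)
      then show ?thesis
        using False by (simp add: linear_scale[OF f] g_def inner_simps dot_square_norm
            power2_eq_square field_simps)
    qed (simp add: g_def)
    show "g v \<in> S" using S v inv by (simp add: g_def subspace_diff subspace_scale)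
    show "g v \<bullet> v = 0" using v by (simp add: g_def inner_simps dot_square_norm l_def)
  qed (use S v in auto)
  then show ?thesis using that[of v l] v by (simp add: g_def)
qed

text \<open>Split off one eigenvector \<open>v\<close>; by symmetry its orthogonal complement in
  \<open>S\<close> is again invariant, and the dimension drops. Orthonormality is recorded only
  through the expansion formula.\<close>

lemma symmetric_eigenbasis:
  fixes f :: "'a::euclidean_space \<Rightarrow> 'a"
  assumes f: "linear f" and sym: "\<And>a b. f a \<bullet> b = a \<bullet> f b"
    and "subspace S" "\<And>a. a \<in> S \<Longrightarrow> f a \<in> S"
  shows "\<exists>B l. finite B \<and> B \<subseteq> S \<and> (\<forall>b\<in>B. f b = l b *\<^sub>R b) \<and> (\<forall>a\<in>S. a = (\<Sum>b\<in>B. (a \<bullet> b) *\<^sub>R b))"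
  using assms(3,4)
proof (induction "dim S" arbitrary: S rule: less_induct)
  case less
  note S = less.prems(1) and inv = less.prems(2)
  show ?case
  proof (cases "S = {0}")
    case True
    then show ?thesis by (intro exI[of _ "{}"]) auto
  next
    case False
    obtain v m where v: "v \<in> S" "norm v = 1" "f v = m *\<^sub>R v"
      using symmetric_has_eigenvector[OF f sym S inv False] by blast
    define S' where "S' = S \<inter> {z. v \<bullet> z = 0}"
    have S': "subspace S'"
      unfolding S'_def by (intro subspace_inter S subspace_hyperplane)
    have inv': "f a \<in> S'" if "a \<in> S'" for a
      using that inv v(3) sym[of v a] by (simp add: S'_def)
    have "v \<notin> S'" using v by (auto simp: S'_def dot_square_norm)
    then have "S' \<subset> S" using v(1) by (metis S'_def inf_le1 psubsetI)
    then have "dim S' < dim S"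
      by (intro dim_psubset) (metis S S' span_eq_iff)
    then obtain B l where B: "finite B" "B \<subseteq> S'" "\<And>b. b \<in> B \<Longrightarrow> f b = l b *\<^sub>R b"
      and expand: "\<And>a. a \<in> S' \<Longrightarrow> a = (\<Sum>b\<in>B. (a \<bullet> b) *\<^sub>R b)"
      using less.hyps[OF _ S' inv'] by metis
    have vB: "v \<notin> B" using B \<open>v \<notin> S'\<close> by blast
    show ?thesis
    proof (intro exI conjI ballI)
      show "finite (insert v B)" "insert v B \<subseteq> S" using B v by (auto simp: S'_def)
      show "f b = (l(v := m)) b *\<^sub>R b" if "b \<in> insert v B" for b
        using that B v vB by auto
      fix a assume a: "a \<in> S"
      have "a - (a \<bullet> v) *\<^sub>R v \<in> S'"
        using a v S by (simp add: S'_def subspace_diff subspace_scale inner_simps dot_square_norm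
            inner_commute)
      then have "a - (a \<bullet> v) *\<^sub>R v = (\<Sum>b\<in>B. ((a - (a \<bullet> v) *\<^sub>R v) \<bullet> b) *\<^sub>R b)"
        by (rule expand)
      \<comment> \<open>The members of \<open>B\<close> are orthogonal to \<open>v\<close>, so
        removing the \<open>v\<close> component leaves the coefficients unchanged.\<close>
      also have "\<dots> = (\<Sum>b\<in>B. (a \<bullet> b) *\<^sub>R b)"
        using B(2) by (intro sum.cong) (auto simp: S'_def inner_simps)
      finally show "a = (\<Sum>b\<in>insert v B. (a \<bullet> b) *\<^sub>R b)"
        using B(1) vB by (simp add: algebra_simps)
    qed
  qed
qed

text \<open>The last two conclusions say that \<open>l\<close> is the orthogonal projection of
  \<open>u0\<close> onto the kernel of \<open>f\<close>. The exponential sum makes sense for all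
  real times, whence the two-sided derivative.\<close>

lemma symmetric_semigroup:
  fixes f :: "'a::euclidean_space \<Rightarrow> 'a"
  assumes f: "linear f" and sym: "\<And>a b. f a \<bullet> b = a \<bullet> f b" and nonneg: "\<And>a. 0 \<le> f a \<bullet> a"
    and S: "subspace S" and inv: "\<And>a. a \<in> S \<Longrightarrow> f a \<in> S" and u0: "u0 \<in> S"
  obtains u l where "u 0 = u0" "\<And>t. u t \<in> S"
    "\<And>t. (u has_vector_derivative - f (u t)) (at t)"
    "(u \<longlongrightarrow> l) at_top" "f l = 0" "\<And>k. f k = 0 \<Longrightarrow> l \<bullet> k = u0 \<bullet> k"
proof -
  obtain B m where B: "finite B" "B \<subseteq> S" and eig: "\<And>b. b \<in> B \<Longrightarrow> f b = m b *\<^sub>R b"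
    and expand: "\<And>a. a \<in> S \<Longrightarrow> a = (\<Sum>b\<in>B. (a \<bullet> b) *\<^sub>R b)"
    using symmetric_eigenbasis[OF f sym S inv] by metis
  define u where "u t = (\<Sum>b\<in>B. exp (- m b * t) *\<^sub>R (u0 \<bullet> b) *\<^sub>R b)" for t
  define l where "l = (\<Sum>b\<in>B. (if m b = 0 then 1 else 0) *\<^sub>R (u0 \<bullet> b) *\<^sub>R b)"
  have term_lim: "((\<lambda>t. exp (- m b * t) *\<^sub>R (u0 \<bullet> b) *\<^sub>R b)
      \<longlongrightarrow> (if m b = 0 then 1 else 0) *\<^sub>R (u0 \<bullet> b) *\<^sub>R b) at_top" if "b \<in> B" for b
  \<comment> \<open>The expansion formula does not by itself exclude \<open>b = 0\<close>, where
    \<open>m b\<close> could have any sign; in the remaining case nonnegativity of \<open>f\<close>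
    gives \<open>m b > 0\<close>.\<close>
  proof (cases "b = 0 \<or> m b = 0")
    case False
    have "0 \<le> m b * (b \<bullet> b)" using nonneg[of b] eig[OF that] by simp
    moreover have "b \<bullet> b > 0" using False by simp
    ultimately have "m b > 0" using False by (simp add: zero_le_mult_iff)
    then have "((\<lambda>t. exp (- m b * t)) \<longlongrightarrow> 0) at_top"
      by (intro filterlim_compose[OF exp_at_bot]
          filterlim_tendsto_neg_mult_at_bot[OF tendsto_const _ filterlim_ident]) auto
    then have "((\<lambda>t. exp (- m b * t) *\<^sub>R (u0 \<bullet> b) *\<^sub>R b) \<longlongrightarrow> 0 *\<^sub>R (u0 \<bullet> b) *\<^sub>R b) at_top"
      by (intro tendsto_scaleR tendsto_const)
    then show ?thesis using False by simp
  qed auto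
  show ?thesis
  proof
    show "u 0 = u0" using expand[OF u0] by (simp add: u_def)
    show "u t \<in> S" for t
      unfolding u_def using B S by (intro subspace_sum) (auto simp: subspace_scale)
    show "(u has_vector_derivative - f (u t)) (at t)" for t
    proof -
      have "(u has_vector_derivative (\<Sum>b\<in>B. (- m b * exp (- m b * t)) *\<^sub>R (u0 \<bullet> b) *\<^sub>R b)) (at t)"
        unfolding u_def
        by (intro has_vector_derivative_sum has_vector_derivative_eq_rhs[OF
              has_vector_derivative_scaleR[OF _ has_vector_derivative_const]])
          (auto intro!: derivative_eq_intros)
      also have "(\<Sum>b\<in>B. (- m b * exp (- m b * t)) *\<^sub>R (u0 \<bullet> b) *\<^sub>R b) = - f (u t)"
        by (simp add: u_def linear_sum[OF f] linear_scale[OF f] eig sum_negf[symmetric]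
            mult.commute mult.left_commute cong: sum.cong)
      finally show ?thesis .
    qed
    show "(u \<longlongrightarrow> l) at_top"
      unfolding u_def l_def by (intro tendsto_sum term_lim)
    show "f l = 0"
      by (auto simp: l_def linear_sum[OF f] linear_scale[OF f] eig linear_0[OF f] intro!: sum.neutral)
    fix k assume k: "f k = 0"
    \<comment> \<open>Eigenvectors with nonzero eigenvalue are orthogonal to the kernel, so dropping
      their terms in \<open>l\<close> does not affect the pairing with \<open>k\<close>.\<close>
    have "b \<bullet> k = 0" if "b \<in> B" "m b \<noteq> 0" for b
      using sym[of b k] eig[OF that(1)] k that(2) by simp
    then have "l \<bullet> k = (\<Sum>b\<in>B. (u0 \<bullet> b) *\<^sub>R b) \<bullet> k"
      by (auto simp: l_def inner_sum_left intro!: sum.cong)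
    then show "l \<bullet> k = u0 \<bullet> k" using expand[OF u0] by simp
  qed
qed

section \<open>Matrices\<close>

text \<open>This bridge lets the real spectral theory above apply to operators that are symmetric
  for the Hilbert-Schmidt inner product.\<close>

lemma inner_eq_Re_hs_inner: "a \<bullet> b = Re (hs_inner a b)"
proof -
  have "a \<bullet> b = (\<Sum>i\<in>UNIV. \<Sum>j\<in>UNIV. Re (cnj (a $ i $ j) * b $ i $ j))"
    by (simp add: inner_vec_def inner_complex_def)
  also have "\<dots> = (\<Sum>j\<in>UNIV. \<Sum>i\<in>UNIV. Re (cnj (a $ i $ j) * b $ i $ j))"
    by (rule sum.swap)
  finally show ?thesis
    by (simp add: hs_inner_def conj_transpose_def trace_def matrix_matrix_mult_def transpose_def)
qed

lemma complex_inner: "a \<bullet> b = Re (cnj a * b)"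
  by (simp add: inner_complex_def)

lemma linear_matrix_mult_left: "linear ((**) (a :: complex ^ 'n ^ 'n))"
  by (rule linearI)
    (simp_all add: matrix_matrix_mult_def vec_eq_iff algebra_simps sum.distrib scaleR_sum_right)

lemma linear_matrix_mult_right: "linear (\<lambda>b. b ** (a :: complex ^ 'n ^ 'n))"
  by (rule linearI)
    (simp_all add: matrix_matrix_mult_def vec_eq_iff algebra_simps sum.distrib scaleR_sum_right)

lemma linear_matrix_vector_mult_left: "linear (\<lambda>a :: complex ^ 'n ^ 'n. a *v v)"
  by (rule linearI)
    (simp_all add: matrix_vector_mult_def vec_eq_iff algebra_simps sum.distrib scaleR_sum_right)

lemma linear_matrix_vector_mult_right: "linear ((*v) (a :: complex ^ 'n ^ 'n))"
  by (rule linearI)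
    (simp_all add: matrix_vector_mult_def vec_eq_iff algebra_simps sum.distrib scaleR_sum_right)

lemma linear_commutator: "linear (commutator (a :: complex ^ 'n ^ 'n))"
  unfolding commutator_def
  by (intro linear_compose_sub linear_matrix_mult_left linear_matrix_mult_right)

lemma inner_commutator:
  "hermitian x \<Longrightarrow> commutator x a \<bullet> b = a \<bullet> commutator x b"
  by (simp add: inner_eq_Re_hs_inner hs_inner_commutator)

lemma conj_transpose_mult: "conj_transpose (a ** b) = conj_transpose b ** conj_transpose a"
  by (simp add: conj_transpose_def matrix_matrix_mult_def transpose_def vec_eq_iff mult.commute)

lemma linear_conj_transpose: "linear (conj_transpose :: complex ^ 'n ^ 'n \<Rightarrow> _)"
  by (rule linearI) (simp_all add: conj_transpose_def transpose_def vec_eq_iff)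

lemma conj_transpose_commutator:
  "hermitian x \<Longrightarrow> conj_transpose (commutator x a) = - commutator x (conj_transpose a)"
  by (simp add: hermitian_def commutator_def linear_diff linear_conj_transpose conj_transpose_mult)

lemma commutator_vector_mult: "commutator a b *v v = a *v (b *v v) - b *v (a *v v)"
  by (simp add: commutator_def matrix_vector_mul_assoc linear_diff[OF linear_matrix_vector_mult_left])

lemma subspace_hermitian: "subspace (Collect hermitian)"
  unfolding subspace_def hermitian_def
  by (simp add: linear_0 linear_add linear_scale linear_conj_transpose)

lemma hermitian_inner:
  assumes "hermitian a"
  shows "(a *v v) \<bullet> w = v \<bullet> (a *v w)"
proof -
  have a: "cnj (a $ i $ j) = a $ j $ i" for i j
    using assms by (auto simp: hermitian_def conj_transpose_def transpose_def vec_eq_iff)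
  have "(a *v v) \<bullet> w = (\<Sum>i\<in>UNIV. \<Sum>j\<in>UNIV. (a $ i $ j * v $ j) \<bullet> w $ i)"
    by (simp add: inner_vec_def matrix_vector_mult_def inner_sum_left)
  also have "\<dots> = (\<Sum>i\<in>UNIV. \<Sum>j\<in>UNIV. v $ j \<bullet> (a $ j $ i * w $ i))"
    by (simp only: complex_inner complex_cnj_mult a mult_ac)
  also have "\<dots> = (\<Sum>j\<in>UNIV. \<Sum>i\<in>UNIV. v $ j \<bullet> (a $ j $ i * w $ i))"
    by (rule sum.swap)
  also have "\<dots> = v \<bullet> (a *v w)"
    by (simp add: inner_vec_def matrix_vector_mult_def inner_sum_right)
  finally show ?thesis .
qed

lemma pos_definite_iff_inner:
  "pos_definite a \<longleftrightarrow> hermitian a \<and> (\<forall>v. v \<noteq> 0 \<longrightarrow> 0 < v \<bullet> (a *v v))"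
  by (simp add: pos_definite_def inner_vec_def inner_complex_def)

section \<open>Commutants, matrix exponentials and generated algebras\<close>

lemma central_imp_scalar:
  fixes a :: "complex ^ 'n ^ 'n"
  assumes "\<And>b. a ** b = b ** a"
  shows "\<exists>c. a = mscale c (mat 1)"
proof -
  define j :: 'n where "j = undefined"
  define c where "c = a $ j $ j"
  have "a $ k $ i = (if k = i then c else 0)" for i k
  proof -
    \<comment> \<open>Test against the matrix unit at \<open>(i, j)\<close> for one fixed, arbitrary
      \<open>j\<close>: column \<open>j\<close> of \<open>a ** e\<close> is column \<open>i\<close>
      of \<open>a\<close>, while column \<open>j\<close> of \<open>e ** a\<close> has only the entry
      \<open>a $ j $ j\<close>, in row \<open>i\<close>.\<close>
    define e :: "complex ^ 'n ^ 'n" where "e = (\<chi> p q. if p = i \<and> q = j then 1 else 0)"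
    have "(a ** e) $ k $ j = a $ k $ i"
      by (simp add: e_def matrix_matrix_mult_def if_distrib cong: if_cong)
    moreover have "(e ** a) $ k $ j = (if k = i then c else 0)"
      by (simp add: c_def e_def matrix_matrix_mult_def if_distrib[of "\<lambda>z. z * _"] cong: if_cong)
    ultimately show ?thesis using assms[of e] by simp
  qed
  then have "a = mscale c (mat 1)"
    by (simp add: mscale_def mat_def vec_eq_iff)
  then show ?thesis ..
qed

text \<open>Powers are iterates of left multiplication by \<open>a\<close>, so a bound
  \<open>K\<close> for that operator dominates the series by the scalar exponential series of
  \<open>K\<close>. Convergence allows multiplication to pass inside the sum.\<close>

lemma summable_mexp:
  fixes a :: "complex ^ 'n ^ 'n"
  shows "summable (\<lambda>k. (1 / fact k) *\<^sub>R (((**) a ^^ k) (mat 1)))"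
proof -
  obtain K where K: "K > 0" "\<And>b :: complex ^ 'n ^ 'n. norm (a ** b) \<le> norm b * K"
    using bounded_linear.pos_bounded[OF
        linear_conv_bounded_linear[THEN iffD1, OF linear_matrix_mult_left[of a]]]
    by blast
  have bound: "norm (((**) a ^^ k) (mat 1)) \<le> K ^ k * norm (mat 1 :: complex ^ 'n ^ 'n)" for k
  proof (induction k)
    case (Suc k)
    have "norm (((**) a ^^ Suc k) (mat 1)) \<le> norm (((**) a ^^ k) (mat 1)) * K"
      using K(2) by simp
    also have "\<dots> \<le> K ^ k * norm (mat 1 :: complex ^ 'n ^ 'n) * K"
      using Suc K(1) by (intro mult_right_mono) auto
    finally show ?case by (simp add: mult_ac)
  qed simp
  show ?thesis
  proof (rule summable_comparison_test')
    show "summable (\<lambda>k. (inverse (fact k) * K ^ k) * norm (mat 1 :: complex ^ 'n ^ 'n))"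
      by (intro summable_mult2 summable_exp)
    show "norm ((1 / fact k) *\<^sub>R (((**) a ^^ k) (mat 1)))
        \<le> (inverse (fact k) * K ^ k) * norm (mat 1 :: complex ^ 'n ^ 'n)" for k
      using bound[of k] by (simp add: field_simps)
  qed
qed

text \<open>Each power of \<open>a\<close> commutes with \<open>b\<close>, and multiplication by
  \<open>b\<close> on either side is a bounded linear map, so it acts termwise.\<close>

lemma mexp_commute:
  fixes a b :: "complex ^ 'n ^ 'n"
  assumes "a ** b = b ** a"
  shows "mexp a ** b = b ** mexp a"
proof -
  have pow: "((**) a ^^ k) (mat 1) ** b = b ** ((**) a ^^ k) (mat 1)" for k
  proof (induction k)
    case (Suc k)
    have "((**) a ^^ Suc k) (mat 1) ** b = a ** (((**) a ^^ k) (mat 1) ** b)"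
      by (simp add: matrix_mul_assoc)
    also have "\<dots> = b ** ((**) a ^^ Suc k) (mat 1)"
      by (simp add: Suc matrix_mul_assoc assms)
    finally show ?case .
  qed simp
  note bl = linear_conv_bounded_linear[THEN iffD1]
  have "mexp a ** b = (\<Sum>k. ((1 / fact k) *\<^sub>R (((**) a ^^ k) (mat 1))) ** b)"
    unfolding mexp_def
    by (rule bounded_linear.suminf[OF bl[OF linear_matrix_mult_right] summable_mexp])
  also have "\<dots> = (\<Sum>k. b ** ((1 / fact k) *\<^sub>R (((**) a ^^ k) (mat 1))))"
    by (simp add: linear_scale[OF linear_matrix_mult_left] linear_scale[OF linear_matrix_mult_right]
        pow)
  also have "\<dots> = b ** mexp a"
    unfolding mexp_def by (rule bounded_linear.suminf[OF bl[OF linear_matrix_mult_left]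
          summable_mexp, symmetric])
  finally show ?thesis .
qed

lemma mscale_mult_left: "mscale c a ** b = mscale c (a ** b)"
  by (simp add: mscale_def matrix_matrix_mult_def vec_eq_iff sum_distrib_left mult.assoc)

lemma mscale_mult_right: "a ** mscale c b = mscale c (a ** b)"
  by (simp add: mscale_def matrix_matrix_mult_def vec_eq_iff sum_distrib_left mult.left_commute)

text \<open>The commutant of \<open>b\<close> is itself a unital algebra, so it contains whatever
  its elements generate.\<close>

lemma generated_algebra_commute:
  assumes "a \<in> generated_algebra S" "\<And>s. s \<in> S \<Longrightarrow> s ** b = b ** s"
  shows "a ** b = b ** a"
  using assms(1)
proof induction
  case (add p q)
  then show ?case
    by (simp add: linear_add[OF linear_matrix_mult_left] linear_add[OF linear_matrix_mult_right])
next
  case (mult p q)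
  then show ?case by (metis matrix_mul_assoc)
qed (simp_all add: assms(2) mscale_mult_left mscale_mult_right)

section \<open>The Laplacian\<close>

context
  fixes x y :: "complex ^ 'n ^ 'n"
  assumes x: "hermitian x" and y: "hermitian y"
begin

lemma linear_laplacian: "linear (laplacian x y)"
proof -
  have "laplacian x y = (\<lambda>a. (commutator y \<circ> commutator y) a + (commutator x \<circ> commutator x) a)"
    by (simp add: fun_eq_iff laplacian_eq x y)
  then show ?thesis
    by (simp only:) (intro linear_compose_add linear_compose linear_commutator)
qed

lemma laplacian_symmetric: "laplacian x y a \<bullet> b = a \<bullet> laplacian x y b"
  by (simp add: laplacian_eq x y inner_simps inner_commutator)

text \<open>The form is a sum of squares: this yields both nonnegativity and the description of the
  kernel.\<close>

lemma laplacian_inner_self: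
  "laplacian x y a \<bullet> a = commutator y a \<bullet> commutator y a + commutator x a \<bullet> commutator x a"
  by (simp add: laplacian_eq x y inner_simps inner_commutator)

text \<open>Each commutator with a hermitian matrix picks up a sign under
  \<open>conj_transpose\<close>; in a double commutator the signs cancel.\<close>

lemma conj_transpose_laplacian: "conj_transpose (laplacian x y a) = laplacian x y (conj_transpose a)"
  by (simp add: laplacian_eq x y linear_add linear_conj_transpose
      conj_transpose_commutator linear_neg[OF linear_commutator])

lemma hermitian_laplacian: "hermitian a \<Longrightarrow> hermitian (laplacian x y a)"
  by (simp add: hermitian_def conj_transpose_laplacian)

lemma laplacian_mscale_mat_1: "laplacian x y (mscale c (mat 1)) = 0"
  by (simp add: laplacian_eq x y commutator_def mscale_mult_left mscale_mult_right)

lemma laplacian_eq_0D: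
  assumes "laplacian x y a = 0"
  shows "x ** a = a ** x" "y ** a = a ** y"
proof -
  have "commutator y a \<bullet> commutator y a + commutator x a \<bullet> commutator x a = 0"
    using laplacian_inner_self[of a] assms by simp
  then have "commutator y a = 0" "commutator x a = 0"
    by (simp_all add: add_nonneg_eq_0_iff)
  then show "x ** a = a ** x" "y ** a = a ** y" by (simp_all add: commutator_def)
qed

lemma laplacian_kernel_scalar:
  assumes gen: "generated_algebra {mexp (mscale p x), mexp (mscale q y)} = UNIV"
    and a: "laplacian x y a = 0"
  shows "\<exists>c. a = mscale c (mat 1)"
proof (rule central_imp_scalar)
  fix b
  have "s ** a = a ** s" if "s \<in> {mexp (mscale p x), mexp (mscale q y)}" for s
    using that laplacian_eq_0D[OF a]
    by (auto intro!: mexp_commute simp: mscale_mult_left mscale_mult_right)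
  then show "a ** b = b ** a"
    using generated_algebra_commute[of b _ a] gen by (metis UNIV_I)
qed

section \<open>The maximum principle for positivity\<close>

lemma laplacian_null_vector:
  assumes w: "hermitian w" "w *v v = 0" and nonneg: "\<And>z. 0 \<le> z \<bullet> (w *v z)"
  shows "v \<bullet> (laplacian x y w *v v) \<le> 0"
proof -
  have double: "v \<bullet> (commutator a (commutator a w) *v v) = - 2 * ((a *v v) \<bullet> (w *v (a *v v)))"
    if "hermitian a" for a :: "complex ^ 'n ^ 'n"
  proof -
    \<comment> \<open>Of the terms \<open>a a w - 2 a w a + w a a\<close>, the first dies because
      \<open>w *v v = 0\<close>, and the last once \<open>w\<close> is moved to the left factor;
      only the middle one survives.\<close>
    have "v \<bullet> (commutator a (commutator a w) *v v)
        = v \<bullet> (w *v (a *v (a *v v))) - 2 * (v \<bullet> (a *v (w *v (a *v v))))"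
      by (simp only: commutator_vector_mult linear_diff[OF linear_matrix_vector_mult_right] w(2)
          linear_0[OF linear_matrix_vector_mult_right] inner_diff_right inner_zero_right)
    also have "\<dots> = - 2 * ((a *v v) \<bullet> (w *v (a *v v)))"
      using w(2) by (simp flip: hermitian_inner[OF w(1)] hermitian_inner[OF that])
    finally show ?thesis .
  qed
  show ?thesis
    using nonneg[of "x *v v"] nonneg[of "y *v v"]
    by (simp add: laplacian_eq x y linear_add[OF linear_matrix_vector_mult_left] inner_simps double)
qed

text \<open>The slope \<open>e\<close> makes the derivative at the first contact strictly positive;
  with a constant barrier it would only be nonnegative, which is no contradiction.\<close>

lemma positivity_barrier:
  fixes u :: "real \<Rightarrow> complex ^ 'n ^ 'n"
  assumes herm: "\<And>t. hermitian (u t)"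
    and deriv: "\<And>t. (u has_vector_derivative - laplacian x y (u t)) (at t)"
    and e: "e > 0" and init: "\<And>v. norm v = 1 \<Longrightarrow> c < v \<bullet> (u 0 *v v)"
    and v: "norm v = 1" and t: "t \<ge> 0"
  shows "c - e * t < v \<bullet> (u t *v v)"
proof (rule ccontr)
  assume neg: "\<not> ?thesis"
  define w where "w s = u s - (c - e * s) *\<^sub>R mat 1" for s
  have form_w: "z \<bullet> (w s *v z) = z \<bullet> (u s *v z) - (c - e * s) * (z \<bullet> z)" for s z
    by (simp add: w_def linear_diff[OF linear_matrix_vector_mult_left]
        linear_scale[OF linear_matrix_vector_mult_left] inner_simps)
  have lap_1: "laplacian x y (mat 1) = 0"
    using laplacian_mscale_mat_1[of 1] by (simp add: mscale_def map_matrix_def)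
  have lap_w: "laplacian x y (w s) = laplacian x y (u s)" for s
    by (simp add: w_def linear_diff[OF linear_laplacian] linear_scale[OF linear_laplacian] lap_1)
  have herm_1: "hermitian (mat 1 :: complex ^ 'n ^ 'n)"
    by (auto simp: hermitian_def conj_transpose_def transpose_def mat_def vec_eq_iff)
  have herm_w: "hermitian (w s)" for s
    using herm[of s] herm_1 subspace_hermitian subspace_diff subspace_scale
    unfolding w_def by (metis mem_Collect_eq)
  have deriv_w: "(w has_vector_derivative - laplacian x y (w s) + e *\<^sub>R mat 1) (at s)" for s
    unfolding lap_w unfolding w_def by (auto intro!: derivative_eq_intros deriv)
  have cont_w: "continuous_on A w" for A
    using deriv_w by (meson continuous_at_imp_continuous_on has_vector_derivative_continuous)
  have deriv_form: "((\<lambda>s. z \<bullet> (w s *v z)) has_real_derivative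
      - (z \<bullet> (laplacian x y (w s) *v z)) + e * (z \<bullet> z)) (at s)" for z s
  proof -
    have "bounded_linear (\<lambda>a. z \<bullet> (a *v z))"
      by (intro bounded_linear_compose[OF bounded_linear_inner_right]
          linear_conv_bounded_linear[THEN iffD1] linear_matrix_vector_mult_left)
    from bounded_linear.has_vector_derivative[OF this deriv_w[of s]] show ?thesis
      by (simp add: has_real_derivative_iff_has_vector_derivative inner_simps
        linear_diff[OF linear_matrix_vector_mult_left] 
        linear_scale[OF linear_matrix_vector_mult_left])
  qed
  \<comment> \<open>Pairs of a time and a unit direction in which \<open>w\<close> fails to be
    positive. This set is compact, so the time coordinate attains its minimum: the first
    contact.\<close>
  define K where "K = ({0..t} \<times> sphere 0 1) \<inter> (\<lambda>(s, z). z \<bullet> (w s *v z)) -` {..0}"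
  have "continuous_on ({0..t} \<times> sphere 0 1) (\<lambda>(s, z). z \<bullet> (w s *v z))"
    unfolding case_prod_unfold matrix_vector_mult_def
    by (intro continuous_intros continuous_on_compose2[OF cont_w[of UNIV]]) auto
  then have "closed K"
    unfolding K_def by (intro continuous_closed_preimage) (auto intro: closed_Times)
  then have "compact (({0..t} \<times> sphere 0 1) \<inter> K)"
    by (intro compact_Int_closed compact_Times) auto
  then have K: "compact K" by (simp add: K_def Int_absorb1 Int_assoc[symmetric])
  have "(t, v) \<in> K" using neg v t by (simp add: K_def form_w dot_square_norm)
  then obtain s z where sz: "(s, z) \<in> K" and first: "\<And>r q. (r, q) \<in> K \<Longrightarrow> s \<le> r"
    using continuous_attains_inf[OF K _ continuous_on_fst[OF continuous_on_id]] by fastforce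
  have z: "norm z = 1" "0 \<le> s" "s \<le> t" "z \<bullet> (w s *v z) \<le> 0" using sz by (auto simp: K_def)
  have "s \<noteq> 0" using z init[OF z(1)] by (auto simp: form_w dot_square_norm)
  then have s: "s > 0" using z by simp
  have before: "0 < q \<bullet> (w r *v q)" if "norm q = 1" "0 \<le> r" "r < s" for q r
  proof (rule ccontr)
    assume "\<not> ?thesis"
    then have "(r, q) \<in> K" using that z by (simp add: K_def)
    then show False using first that by fastforce
  qed
  \<comment> \<open>Positivity before time \<open>s\<close> survives as nonnegativity in the limit
    from the left.\<close>
  have unit_nonneg: "0 \<le> q \<bullet> (w s *v q)" if "norm q = 1" for q
  proof (rule tendsto_lowerbound)
    show "((\<lambda>r. q \<bullet> (w r *v q)) \<longlongrightarrow> q \<bullet> (w s *v q)) (at_left s)"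
      using DERIV_isCont[OF deriv_form[of q s]] by (simp add: isCont_def filterlim_at_split)
    show "\<forall>\<^sub>F r in at_left s. 0 \<le> q \<bullet> (w r *v q)"
      by (rule eventually_mono[OF eventually_at_left_real[OF s]])
        (auto intro: less_imp_le before that)
  qed simp
  have nonneg: "0 \<le> q \<bullet> (w s *v q)" for q
  proof (cases "q = 0")
    case False
    then have "0 \<le> (1 / norm q) *\<^sub>R q \<bullet> (w s *v ((1 / norm q) *\<^sub>R q))"
      by (intro unit_nonneg) simp
    then show ?thesis
      using False by (auto simp: linear_scale[OF linear_matrix_vector_mult_right] zero_le_mult_iff
          zero_le_divide_iff mult_le_0_iff)
  qed simp
  have zero: "z \<bullet> (w s *v z) = 0" using z nonneg[of z] by simp
  have "w s *v z = 0"
    using zero nonneg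
    by (intro symmetric_nonneg_null[OF linear_matrix_vector_mult_right hermitian_inner[OF herm_w]
          subspace_UNIV])
      (auto simp: inner_commute)
  then have "z \<bullet> (laplacian x y (w s) *v z) \<le> 0"
    by (intro laplacian_null_vector herm_w nonneg)
  then have "0 < - (z \<bullet> (laplacian x y (w s) *v z)) + e * (z \<bullet> z)"
    using e z by (simp add: dot_square_norm)
  then obtain d where d: "d > 0" "\<And>h. 0 < h \<Longrightarrow> h < d \<Longrightarrow> z \<bullet> (w (s - h) *v z) < z \<bullet> (w s *v z)"
    using DERIV_pos_inc_left[OF deriv_form] by blast
  \<comment> \<open>The bound by \<open>s\<close> keeps \<open>s - h\<close> in the interval where
    the form is still positive, while the positive derivative puts its value there below
    \<open>0\<close>.\<close>
  define h where "h = min (d / 2) s"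
  have h: "0 < h" "h < d" "h \<le> s" using d(1) s by (auto simp: h_def)
  then show False
    using d(2)[of h] before[of z "s - h"] z(1) zero by simp
qed

lemma positivity_preserved:
  fixes u :: "real \<Rightarrow> complex ^ 'n ^ 'n"
  assumes herm: "\<And>t. hermitian (u t)"
    and deriv: "\<And>t. (u has_vector_derivative - laplacian x y (u t)) (at t)"
    and pos: "pos_definite (u 0)" and t: "t \<ge> 0"
  shows "pos_definite (u t)"
proof -
  have "continuous_on (sphere 0 1) (\<lambda>v. v \<bullet> (u 0 *v v))"
    by (intro continuous_intros linear_continuous_on linear_conv_bounded_linear[THEN iffD1]
        linear_matrix_vector_mult_right)
  then obtain z where z: "norm z = 1" and min: "\<And>v. norm v = 1 \<Longrightarrow> z \<bullet> (u 0 *v z) \<le> v \<bullet> (u 0 *v v)"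
    using continuous_attains_inf[of "sphere 0 1" "\<lambda>v. v \<bullet> (u 0 *v v)"]
    by (auto simp: ex_in_conv)
  \<comment> \<open>Half of the minimum over the unit sphere, so that the initial bound required by
    the barrier is strict.\<close>
  define c where "c = z \<bullet> (u 0 *v z) / 2"
  have "z \<noteq> 0" using z by auto
  then have c: "c > 0" using pos by (simp add: c_def pos_definite_iff_inner)
  have "0 < v \<bullet> (u t *v v)" if "v \<noteq> 0" for v
  proof -
    let ?v = "(1 / norm v) *\<^sub>R v"
    \<comment> \<open>The slope \<open>c / (t + 1)\<close> is small enough for the barrier to be
      still nonnegative at time \<open>t\<close>, where it equals
      \<open>c / (t + 1)\<close>.\<close>
    have "c - c / (t + 1) * t < ?v \<bullet> (u t *v ?v)"
    proof (rule positivity_barrier[OF herm deriv])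
      show "c < q \<bullet> (u 0 *v q)" if "norm q = 1" for q
        using min[OF that] c by (simp add: c_def)
    qed (use c t that in auto)
    moreover have "0 \<le> c - c / (t + 1) * t" using c t by (simp add: field_simps)
    ultimately have "0 < ?v \<bullet> (u t *v ?v)" by linarith
    then show ?thesis
      using that by (simp add: linear_scale[OF linear_matrix_vector_mult_right] zero_less_mult_iff
          zero_less_divide_iff)
  qed
  then show ?thesis using herm by (simp add: pos_definite_iff_inner)
qed

end

section \<open>Identification of the limit through its trace\<close>

lemma inner_mscale_mat_1: "a \<bullet> mscale c (mat 1) = Re (cnj (trace a) * c)"
proof -
  have "a $ i $ j \<bullet> mscale c (mat 1) $ i $ j = (if i = j then a $ i $ i \<bullet> c else 0)" for i j
    by (simp add: mscale_def mat_def)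
  then have "a \<bullet> mscale c (mat 1) = (\<Sum>i\<in>UNIV. a $ i $ i \<bullet> c)"
    by (simp add: inner_vec_def)
  then show ?thesis by (simp add: trace_def complex_inner sum_distrib_right)
qed

theorem theorem4p1:
  fixes x y U V u0 :: "complex ^ 'n ^ 'n"
  assumes "hermitian x" and "hermitian y"
    and "U = mexp (mscale (2 * of_real pi * \<i> / of_nat CARD('n)) x)"
    and "V = mexp (mscale (2 * of_real pi * \<i> / of_nat CARD('n)) y)"
    and "generated_algebra {U, V} = UNIV"
  shows "\<exists>u. heat_solution x y u0 u
           \<and> (u \<longlongrightarrow> mean u0) at_top
           \<and> (pos_definite u0 \<longrightarrow> (\<forall>t>0. pos_definite (u t)))"
proof -
  note xy = assms(1,2)
  \<comment> \<open>One construction covers both claims: for hermitian \<open>u0\<close> the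
    solution is confined to hermitian matrices, as the positivity argument requires, and otherwise
    \<open>S\<close> imposes no restriction.\<close>
  define S :: "(complex ^ 'n ^ 'n) set" where "S = (if hermitian u0 then Collect hermitian else UNIV)"
  have S: "subspace S" "u0 \<in> S" and inv: "\<And>a. a \<in> S \<Longrightarrow> laplacian x y a \<in> S"
    by (auto simp: S_def subspace_hermitian hermitian_laplacian xy)
  have nonneg: "0 \<le> laplacian x y a \<bullet> a" for a
    by (simp add: laplacian_inner_self xy)
  obtain u l where u: "u 0 = u0" "\<And>t. u t \<in> S"
      "\<And>t. (u has_vector_derivative - laplacian x y (u t)) (at t)"
    and l: "(u \<longlongrightarrow> l) at_top" "laplacian x y l = 0" "\<And>k. laplacian x y k = 0 \<Longrightarrow> l \<bullet> k = u0 \<bullet> k"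
    using symmetric_semigroup[OF linear_laplacian[OF xy] laplacian_symmetric[OF xy] nonneg S(1) inv S(2)]
    by blast
  obtain c where c: "l = mscale c (mat 1)"
    using laplacian_kernel_scalar[OF xy _ l(2)] assms(3-5) by blast
  have "Re (cnj (trace l) * k) = Re (cnj (trace u0) * k)" for k
    using l(3)[OF laplacian_mscale_mat_1[OF xy]] by (simp only: inner_mscale_mat_1)
  \<comment> \<open>Pairing with the identity gives the real part of the trace, pairing with
    \<open>\<i>\<close> times the identity its imaginary part.\<close>
  from this[of 1] this[of \<i>] have "trace l = trace u0" by (simp add: complex_eq_iff)
  moreover have "trace l = of_nat CARD('n) * c"
    by (simp add: c trace_def mscale_def mat_def)
  ultimately have "c = trace u0 / of_nat CARD('n)" by (simp add: field_simps)
  then have "l = mean u0" by (simp add: c mean_def)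
  moreover have "heat_solution x y u0 u"
    using u by (auto simp: heat_solution_def intro: has_vector_derivative_at_within)
  moreover have "pos_definite (u t)" if "pos_definite u0" "t > 0" for t
  proof (rule positivity_preserved[OF xy])
    have "hermitian u0" using that by (simp add: pos_definite_def)
    then show "hermitian (u r)" for r using u(2)[of r] by (simp add: S_def)
  qed (use u that in auto)
  ultimately show ?thesis using l(1) by blast
qed

end
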